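(* The graph property "there is no isolated vertex" (that is, every vertex in $\mathbb{N}$ is covered by at least one edge of the graph), for graphs on the vertex set $\mathbb{N}$, is not $\infty$-elusive.
   Context: Let $[\mathbb{N}]^2=\{\{n,k\}: n,k\in\mathbb{N},\ n\neq k\}$. A graph on $\mathbb{N}$ is a subset $G\subseteq[\mathbb{N}]^2$, so the set of graphs is $2^{[\mathbb{N}]^2}$. A graph property is an isomorphism-invariant subset $\mathcal{S}\subseteq 2^{[\mathbb{N}]^2}$. The game $G(\mathcal{S})$. Two players, Seeker and Hider, colour the edges of the complete graph on $\mathbb{N}$ with red, white, green. Initially all edges are white. In each turn Seeker picks a white edge and Hider recolours it green or red. The game terminates after infinitely many (that is, $\omega$ many) turns. Let $R_\infty,W_\infty,G_\infty$ be the sets of red, white and green edges at the end, and let $\mathcal{P}_\infty=\{G\subseteq[\mathbb{N}]^2: G_\infty\subseteq G\subseteq G_\infty\cup W_\infty\}$. Seeker wins if and only if $W_\infty\neq\emptyset$ and either $\mathcal{P}_\infty\subseteq\mathcal{S}$ or $\mathcal{P}_\infty\subseteq 2^{[\mathbb{N}]^2}\setminus\mathcal{S}$; otherwise Hider wins. The property $\mathcal{S}$ is $\infty$-elusive if Seeker does not have a winning strategy in $G(\mathcal{S})$; thus "not $\infty$-elusive" means that Seeker has a winning strategy in $G(\mathcal{S})$. *)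

theory Defs
  imports "HOL-Library.Ramsey"
begin

type_synonym edge = "nat set"
type_synonym graph = "edge set"

abbreviation all_edges :: "edge set" where
  "all_edges \<equiv> nsets (UNIV :: nat set) 2"

definition graph_property :: "graph set \<Rightarrow> bool" where
  "graph_property \<S> \<longleftrightarrow>
     \<S> \<subseteq> Pow all_edges \<and>
     (\<forall>\<pi> :: nat \<Rightarrow> nat. bij \<pi> \<longrightarrow> (\<forall>G \<in> \<S>. (\<lambda>e. \<pi> ` e) ` G \<in> \<S>))"

text \<open>
  The colours available to Hider; an edge is white as long as it has not been picked.
  A turn is the edge picked by Seeker together with the colour chosen by Hider, and a play is
  an infinite sequence of turns.
\<close>

datatype colour = Red | Green

type_synonym turn = "edge \<times> colour"
type_synonym play = "nat \<Rightarrow> turn"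

definition white_before :: "play \<Rightarrow> nat \<Rightarrow> edge set" where
  "white_before p t = all_edges - {fst (p s) | s. s < t}"

definition legal_play :: "play \<Rightarrow> bool" where
  "legal_play p \<longleftrightarrow> (\<forall>t. fst (p t) \<in> white_before p t)"

definition red_end :: "play \<Rightarrow> edge set" where
  "red_end p = {e. \<exists>t. p t = (e, Red)}"

definition green_end :: "play \<Rightarrow> edge set" where
  "green_end p = {e. \<exists>t. p t = (e, Green)}"

definition white_end :: "play \<Rightarrow> edge set" where
  "white_end p = all_edges - (red_end p \<union> green_end p)"

definition possible_graphs :: "play \<Rightarrow> graph set" where
  "possible_graphs p = {G. G \<subseteq> all_edges \<and> green_end p \<subseteq> G \<and> G \<subseteq> green_end p \<union> white_end p}"

definition seeker_wins :: "graph set \<Rightarrow> play \<Rightarrow> bool" where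
  "seeker_wins \<S> p \<longleftrightarrow>
     white_end p \<noteq> {} \<and>
     (possible_graphs p \<subseteq> \<S> \<or> possible_graphs p \<subseteq> Pow all_edges - \<S>)"

text \<open>A strategy for Seeker maps the finite list of past turns to the next edge.\<close>

type_synonym strategy = "turn list \<Rightarrow> edge"

definition follows :: "play \<Rightarrow> strategy \<Rightarrow> bool" where
  "follows p \<sigma> \<longleftrightarrow> (\<forall>t. fst (p t) = \<sigma> (map p [0..<t]))"

text \<open>
  Hider's colours in a play that follows a strategy are arbitrary, so the quantification over
  plays covers all behaviours of Hider. Legality is required as a conclusion: the strategy must
  always pick a white edge.
\<close>

definition winning_strategy :: "graph set \<Rightarrow> strategy \<Rightarrow> bool" where
  "winning_strategy \<S> \<sigma> \<longleftrightarrow> (\<forall>p. follows p \<sigma> \<longrightarrow> legal_play p \<and> seeker_wins \<S> p)"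

definition infinitely_elusive :: "graph set \<Rightarrow> bool" where
  "infinitely_elusive \<S> \<longleftrightarrow> \<not> (\<exists>\<sigma>. winning_strategy \<S> \<sigma>)"

definition no_isolated_vertex :: "graph set" where
  "no_isolated_vertex = {G. G \<subseteq> all_edges \<and> (\<forall>v :: nat. \<exists>e \<in> G. v \<in> e)}"

lemma graph_property_no_isolated_vertex: "graph_property no_isolated_vertex"
  unfolding graph_property_def
proof (intro conjI allI impI ballI)
  show "no_isolated_vertex \<subseteq> Pow all_edges"
    by (auto simp: no_isolated_vertex_def)
next
  fix \<pi> :: "nat \<Rightarrow> nat" and G
  assume \<pi>: "bij \<pi>" and G: "G \<in> no_isolated_vertex"
  have "\<pi> ` e \<in> all_edges" if "e \<in> G" for e
  proof -
    have "e \<in> all_edges"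
      using G that by (auto simp: no_isolated_vertex_def)
    then show ?thesis
      using card_image[OF inj_on_subset[OF bij_is_inj[OF \<pi>] subset_UNIV], of e]
      by (simp add: nsets_def)
  qed
  moreover have "\<exists>e \<in> (\<lambda>e. \<pi> ` e) ` G. v \<in> e" for v
  proof -
    obtain u where u: "v = \<pi> u"
      using bij_is_surj[OF \<pi>] by (metis surjD)
    obtain e where "e \<in> G" "u \<in> e"
      using G by (auto simp: no_isolated_vertex_def)
    then show ?thesis
      using u by blast
  qed
  ultimately show "(\<lambda>e. \<pi> ` e) ` G \<in> no_isolated_vertex"
    by (auto simp: no_isolated_vertex_def)
qed

end

theory Submission
  imports Defs "HOL-Library.Omega_Words_Fun" "HOL-Library.Countable_Set" "HOL-Library.Nat_Bijection"
begin

text \<open>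
  Call a vertex covered once one of its edges is green. Seeker has two kinds of winning end
  positions: every vertex is covered, or some vertex has only red edges; in both cases one edge
  must stay white. The decisive observation is that two covered vertices joined by a white edge
  suffice: Seeker reserves this edge and asks all others, after which every vertex is either
  covered or has only red edges (\<open>winning_if_white_edge_between_covered\<close>). So Hider must never
  let a vertex become covered while it has a white edge to another covered vertex.

  This threat leaves Hider essentially one way to answer. Seeker first asks the edges at 0. If all
  answers are red, then 0 is isolated; otherwise some first edge \<open>{a, b}\<close> is green. Now let \<open>K\<close> be a
  vertex that has not been touched. Seeker adds new vertices one after the other to the set of
  covered vertices: for a new vertex \<open>x\<close> the edges to all covered vertices are asked. Hider must
  answer red as long as \<open>x\<close> has another white edge to a covered vertex, but must answer the last of
  these edges green: otherwise Seeker asks the remaining edges at \<open>x\<close>, whose other ends all still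
  have a white edge to a covered vertex, so Hider has to colour them all red and \<open>x\<close> is isolated
  (\<open>winning_after_last_red\<close>). In between Seeker asks the edges at \<open>K\<close>, but more slowly than covered
  vertices appear. At every moment \<open>K\<close> has a white edge to some covered vertex, so Hider has to
  colour each edge at \<open>K\<close> red, and yet every edge at \<open>K\<close> is asked eventually. In the end \<open>K\<close>
  is isolated.

  Hence there is a single play in which each answer of Hider is forced, in the sense that the
  other answer loses, and which Seeker wins. By \<open>winning_if_deviations_winning\<close> this is enough for
  a winning strategy.
\<close>

section \<open>Winning positions\<close>

definition asked :: "turn list \<Rightarrow> edge set" where
  "asked h = fst ` set h"

definition fresh :: "turn list \<Rightarrow> play \<Rightarrow> bool" where
  "fresh h q \<longleftrightarrow> (\<forall>n. fst (q n) \<in> all_edges - asked (h @ map q [0..<n]))"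

text \<open>
  The strategy reads only the turns made after the position \<open>h\<close>, and \<open>q\<close> consists of these turns.
  So a strategy that was found for a later position can be used unchanged in the middle of a play.
\<close>

definition winning :: "graph set \<Rightarrow> turn list \<Rightarrow> bool" where
  "winning \<S> h \<longleftrightarrow> (\<exists>\<sigma>. \<forall>q. follows q \<sigma> \<longrightarrow> fresh h q \<and> seeker_wins \<S> (h \<frown> q))"

lemma winning_Nil_iff: "winning \<S> [] \<longleftrightarrow> (\<exists>\<sigma>. winning_strategy \<S> \<sigma>)"
proof -
  have "fresh [] q \<longleftrightarrow> legal_play q" for q
  proof -
    have "fst ` q ` {0..<t} = {fst (q s) |s. s < t}" for t
      by auto
    then show ?thesis
      by (simp add: fresh_def legal_play_def white_before_def asked_def)
  qed
  then show ?thesis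
    by (simp add: winning_def winning_strategy_def)
qed

text \<open>
  Seeker follows \<open>q\<close> as long as Hider answers as in \<open>q\<close>, and switches to a strategy for the
  position reached at Hider's first deviation. This replaces the description of a complete strategy
  by that of one play.
\<close>

lemma winning_if_deviations_winning:
  assumes fresh: "fresh h q"
    and wins: "seeker_wins \<S> (h \<frown> q)"
    and dev: "\<And>n c. c \<noteq> snd (q n) \<Longrightarrow> winning \<S> (h @ map q [0..<n] @ [(fst (q n), c)])"
  shows "winning \<S> h"
proof -
  define dev_pos where "dev_pos g \<longleftrightarrow>
    (\<exists>n c. c \<noteq> snd (q n) \<and> g = map q [0..<n] @ [(fst (q n), c)])" for g
  have "\<forall>g. \<exists>\<tau>. dev_pos g \<longrightarrow>
      (\<forall>r. follows r \<tau> \<longrightarrow> fresh (h @ g) r \<and> seeker_wins \<S> ((h @ g) \<frown> r))"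
    using dev unfolding dev_pos_def winning_def by metis
  then obtain \<tau> where \<tau>: "\<And>g r. dev_pos g \<Longrightarrow> follows r (\<tau> g) \<Longrightarrow>
      fresh (h @ g) r \<and> seeker_wins \<S> ((h @ g) \<frown> r)"
    by metis
  \<comment> \<open>For a history of turns that differs from \<open>q\<close>, the strategy recovers the position right after
    the deviation as a prefix of the history.\<close>
  define first_dev where "first_dev g = (LEAST n. g ! n \<noteq> q n)" for g :: "turn list"
  define \<sigma> where "\<sigma> g =
    (if g = map q [0..<length g] then fst (q (length g))
     else let m = Suc (first_dev g) in \<tau> (take m g) (drop m g))" for g
  have "fresh h r \<and> seeker_wins \<S> (h \<frown> r)" if r: "follows r \<sigma>" for r
  proof (cases "r = q")
    case True
    show ?thesis
      unfolding True using fresh wins by blast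
  next
    case False
    define n where "n = (LEAST n. r n \<noteq> q n)"
    obtain m where "r m \<noteq> q m"
      using False by (auto simp: fun_eq_iff)
    then have neq: "r n \<noteq> q n"
      unfolding n_def by (rule LeastI)
    have before: "r m = q m" if "m < n" for m
      using that not_less_Least unfolding n_def by blast
    have same: "map r [0..<m] = map q [0..<m]" if "m \<le> n" for m
      using that before by simp
    have "\<sigma> (map r [0..<n]) = fst (q n)"
      using same[of n] by (simp add: \<sigma>_def)
    then have fst_n: "fst (r n) = fst (q n)"
      using r by (simp add: follows_def)
    then have snd_n: "snd (r n) \<noteq> snd (q n)"
      using neq by (simp add: prod_eq_iff)
    define g where "g = map r [0..<Suc n]"
    have "dev_pos g"
      unfolding dev_pos_def g_def
      using snd_n same[of n] fst_n by (intro exI[of _ n] exI[of _ "snd (r n)"]) (simp add: prod_eq_iff)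
    have split_r: "map r [0..<Suc n + k] = g @ map (suffix (Suc n) r) [0..<k]" for k
      by (induction k) (simp_all add: g_def)
    have len: "length g = Suc n"
      by (simp add: g_def)
    have "\<sigma> (map r [0..<Suc n + k]) = \<tau> g (map (suffix (Suc n) r) [0..<k])" for k
    proof -
      let ?r = "map r [0..<Suc n + k]"
      have nth: "?r ! m = r m" if "m \<le> n" for m
        using that by (subst nth_map) (simp_all del: upt_Suc)
      have "first_dev ?r = n"
        unfolding first_dev_def
      proof (rule Least_equality)
        show "?r ! n \<noteq> q n"
          using neq nth by simp
        show "n \<le> m" if "?r ! m \<noteq> q m" for m
          using that nth before by (metis less_imp_le not_le)
      qed
      moreover have "?r \<noteq> map q [0..<length ?r]"
      proof
        assume *: "?r = map q [0..<length ?r]"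
        have "?r ! n = q n"
          by (subst *) (simp add: nth_append del: upt_Suc)
        then show False
          using nth[of n] neq by simp
      qed
      moreover have "take (Suc n) ?r = g" "drop (Suc n) ?r = map (suffix (Suc n) r) [0..<k]"
        unfolding split_r using len by simp_all
      ultimately show ?thesis
        unfolding \<sigma>_def Let_def by (simp only: if_False)
    qed
    then have "follows (suffix (Suc n) r) (\<tau> g)"
      using r by (simp add: follows_def)
    then have tail: "fresh (h @ g) (suffix (Suc n) r)"
      and tail_wins: "seeker_wins \<S> ((h @ g) \<frown> suffix (Suc n) r)"
      using \<tau> \<open>dev_pos g\<close> by auto
    have "r = g \<frown> suffix (Suc n) r"
      using prefix_suffix[of r "Suc n"] by (simp add: g_def subsequence_def)
    then have "seeker_wins \<S> (h \<frown> r)"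
      using tail_wins by (metis conc_conc)
    moreover have "fst (r m) \<in> all_edges - asked (h @ map r [0..<m])" for m
    proof (cases "m \<le> n")
      case True
      then have "fst (r m) = fst (q m)"
        using before fst_n by (cases "m = n") auto
      then show ?thesis
        using fresh same[OF True] unfolding fresh_def by metis
    next
      case False
      then obtain k where m: "m = Suc n + k"
        by (metis add_Suc less_iff_Suc_add not_le)
      show ?thesis
        using tail split_r[of k] unfolding fresh_def m by (metis append.assoc suffix_nth)
    qed
    ultimately show ?thesis
      unfolding fresh_def by blast
  qed
  then show ?thesis
    unfolding winning_def by blast
qed

lemma white_end_eq: "white_end p = all_edges - fst ` range p"
proof -
  have "e \<in> red_end p \<union> green_end p \<longleftrightarrow> e \<in> fst ` range p" for e
  proof
    assume "e \<in> fst ` range p"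
    then obtain t where "fst (p t) = e"
      by auto
    then have "p t = (e, Red) \<or> p t = (e, Green)"
      by (cases "p t"; cases "snd (p t)") auto
    then show "e \<in> red_end p \<union> green_end p"
      by (auto simp: red_end_def green_end_def)
  next
    assume "e \<in> red_end p \<union> green_end p"
    then show "e \<in> fst ` range p"
      unfolding red_end_def green_end_def by (auto simp: image_image) (metis fst_conv rangeI)+
  qed
  then show ?thesis
    unfolding white_end_def by blast
qed

lemma seeker_wins_if_covered:
  assumes "e \<in> all_edges" "e \<notin> fst ` range p"
    and "\<And>w. \<exists>e. (e, Green) \<in> range p \<and> w \<in> e"
  shows "seeker_wins no_isolated_vertex p"
proof -
  have "e \<in> white_end p"
    using assms(1,2) by (simp add: white_end_eq)
  moreover have "possible_graphs p \<subseteq> no_isolated_vertex"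
  proof
    fix G assume G: "G \<in> possible_graphs p"
    have "\<exists>e\<in>G. w \<in> e" for w
    proof -
      obtain e t where "p t = (e, Green)" "w \<in> e"
        using assms(3)[of w] by (metis rangeE)
      then show ?thesis
        using G by (auto simp: possible_graphs_def green_end_def)
    qed
    then show "G \<in> no_isolated_vertex"
      using G by (simp add: no_isolated_vertex_def possible_graphs_def)
  qed
  ultimately show ?thesis
    unfolding seeker_wins_def by blast
qed

lemma seeker_wins_if_isolated:
  assumes "e \<in> all_edges" "e \<notin> fst ` range p"
    and all: "\<And>e. e \<in> all_edges \<Longrightarrow> w \<in> e \<Longrightarrow> e \<in> fst ` range p"
    and red: "\<And>e c. (e, c) \<in> range p \<Longrightarrow> w \<in> e \<Longrightarrow> c = Red"
  shows "seeker_wins no_isolated_vertex p"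
proof -
  have "e \<in> white_end p"
    using assms(1,2) by (simp add: white_end_eq)
  moreover have "possible_graphs p \<subseteq> Pow all_edges - no_isolated_vertex"
  proof
    fix G assume G: "G \<in> possible_graphs p"
    have "w \<notin> e" if "e \<in> G" for e
    proof
      assume w: "w \<in> e"
      have "e \<in> all_edges"
        using G that by (auto simp: possible_graphs_def)
      then obtain c t where t: "p t = (e, c)"
        using all[OF _ w] by (metis imageE prod.collapse)
      then have "p t = (e, Red)"
        using red[OF _ w] by (metis rangeI)
      moreover have "p s \<noteq> (e, Green)" for s
        using red[OF _ w] by (metis colour.distinct(1) rangeI)
      ultimately show False
        using G that by (auto simp: possible_graphs_def white_end_def red_end_def green_end_def)
    qed
    then show "G \<in> Pow all_edges - no_isolated_vertex"
      using G by (auto simp: no_isolated_vertex_def possible_graphs_def)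
  qed
  ultimately show ?thesis
    unfolding seeker_wins_def by blast
qed

section \<open>Two ways to win\<close>

definition covered :: "turn list \<Rightarrow> nat \<Rightarrow> bool" where
  "covered h w \<longleftrightarrow> (\<exists>e. (e, Green) \<in> set h \<and> w \<in> e)"

lemma covered_append [simp]: "covered (g @ h) w \<longleftrightarrow> covered g w \<or> covered h w"
  by (auto simp: covered_def)

lemma covered_Nil [simp]: "\<not> covered [] w"
  by (simp add: covered_def)

lemma covered_Cons [simp]: "covered (t # h) w \<longleftrightarrow> snd t = Green \<and> w \<in> fst t \<or> covered h w"
  by (cases t) (auto simp: covered_def)

lemma asked_append [simp]: "asked (g @ h) = asked g \<union> asked h"
  by (auto simp: asked_def)

lemma asked_Nil [simp]: "asked [] = {}"
  by (simp add: asked_def)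

lemma asked_Cons [simp]: "asked (t # h) = insert (fst t) (asked h)"
  by (simp add: asked_def)

lemma finite_asked [simp]: "finite (asked h)"
  by (simp add: asked_def)

lemma infinite_star: "infinite {e \<in> all_edges. (x::nat) \<in> e}"
proof -
  have "inj (\<lambda>n. {x, x + Suc n})"
    by (auto simp: inj_def doubleton_eq_iff)
  then have "infinite (range (\<lambda>n. {x, x + Suc n}))"
    by (rule range_inj_infinite)
  then show ?thesis
    by (rule infinite_super[rotated]) auto
qed

lemma countable_all_edges: "countable all_edges"
  by (rule countable_subset[OF _ countable_Collect_finite]) (auto simp: nsets_def)

lemma ex_enumeration:
  assumes "E \<subseteq> all_edges" "infinite E"
  obtains f :: "nat \<Rightarrow> edge" where "bij_betw f UNIV E"
  using assms bij_betw_from_nat_into countable_subset[OF _ countable_all_edges] by metis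

lemma fresh_if_enumeration:
  assumes "bij_betw f UNIV E" "E \<subseteq> all_edges - asked h" "\<And>n. fst (q n) = f n"
  shows "fresh h q"
proof -
  have "inj f" "range f = E"
    using assms(1) by (auto simp: bij_betw_def)
  moreover have "asked (map q [0..<n]) = f ` {..<n}" for n
    using assms(3) by (auto simp: asked_def image_image)
  ultimately have "f n \<in> all_edges - asked (h @ map q [0..<n])" for n
  proof -
    have "f n \<in> E" "f n \<notin> f ` {..<n}"
      using \<open>range f = E\<close> \<open>inj f\<close> by (auto simp: inj_def)
    then show ?thesis
      using assms(2) \<open>\<And>n. asked (map q [0..<n]) = f ` {..<n}\<close>[of n] by auto
  qed
  then show ?thesis
    using assms(3) unfolding fresh_def by simp
qed

text \<open>
  Seeker asks every edge except the reserved \<open>{a, b}\<close>, in an order fixed in advance. Since \<open>a\<close> and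
  \<open>b\<close> are covered already, a vertex that is uncovered at the end is not on the white edge and has
  only red edges.
\<close>

lemma winning_if_white_edge_between_covered:
  assumes "covered h a" "covered h b" "a \<noteq> b" "{a, b} \<notin> asked h"
  shows "winning no_isolated_vertex h"
proof -
  define E where "E = all_edges - insert {a, b} (asked h)"
  have "infinite all_edges"
    using infinite_star[of 0] infinite_super[of "{e \<in> all_edges. 0 \<in> e}" all_edges] by blast
  then have "infinite E"
    by (simp add: E_def)
  then obtain f :: "nat \<Rightarrow> edge" where f: "bij_betw f UNIV E"
    using ex_enumeration[of E] by (auto simp: E_def)
  have "fresh h q \<and> seeker_wins no_isolated_vertex (h \<frown> q)"
    if q: "follows q (\<lambda>g. f (length g))" for q
  proof
    have fst_q: "fst (q n) = f n" for n
      using q by (simp add: follows_def)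
    then show "fresh h q"
      using f by (intro fresh_if_enumeration) (auto simp: E_def)
    have "range f = E"
      using f by (simp add: bij_betw_def)
    then have range_q: "fst ` range q = E"
      using fst_q by (simp add: image_image)
    have ab: "{a, b} \<in> all_edges" "{a, b} \<notin> fst ` range (h \<frown> q)"
      using assms(3,4) range_q by (auto simp: E_def asked_def image_Un)
    have all: "e \<in> fst ` range (h \<frown> q)" if "e \<in> all_edges" "e \<noteq> {a, b}" for e
      using that range_q by (auto simp: E_def asked_def image_Un)
    show "seeker_wins no_isolated_vertex (h \<frown> q)"
    proof (cases "\<forall>w. \<exists>e. (e, Green) \<in> range (h \<frown> q) \<and> w \<in> e")
      case True
      then show ?thesis
        using seeker_wins_if_covered ab by blast
    next
      case False
      then obtain w where w: "\<And>e. (e, Green) \<in> range (h \<frown> q) \<Longrightarrow> w \<notin> e"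
        by blast
      then have "\<not> covered h w"
        by (auto simp: covered_def)
      then have "w \<noteq> a" "w \<noteq> b"
        using assms(1,2) by auto
      show ?thesis
        using ab
      proof (rule seeker_wins_if_isolated)
        show "e \<in> fst ` range (h \<frown> q)" if "e \<in> all_edges" "w \<in> e" for e
          using all[of e] that \<open>w \<noteq> a\<close> \<open>w \<noteq> b\<close> by blast
        show "c = Red" if "(e, c) \<in> range (h \<frown> q)" "w \<in> e" for e c
          using that w[of e] by (cases c) blast+
      qed
    qed
  qed
  then show ?thesis
    unfolding winning_def by blast
qed

text \<open>
  Seeker asks all remaining edges at \<open>x\<close>. If every answer is red, then \<open>x\<close> is isolated, and a white
  edge remains since the finitely many edges in \<open>h\<close> and the edges at \<open>x\<close> do not exhaust the edges at
  another vertex. Here \<open>g\<close> consists of the red answers before the first green one.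
\<close>

lemma winning_star:
  assumes red: "\<And>e c. (e, c) \<in> set h \<Longrightarrow> x \<in> e \<Longrightarrow> c = Red"
    and dev: "\<And>g w. set g \<subseteq> {({x, u}, Red) | u. u \<noteq> x} \<Longrightarrow> w \<noteq> x \<Longrightarrow>
      {x, w} \<notin> asked (h @ g) \<Longrightarrow> winning no_isolated_vertex (h @ g @ [({x, w}, Green)])"
  shows "winning no_isolated_vertex h"
proof -
  define E where "E = {e \<in> all_edges. x \<in> e} - asked h"
  have "infinite E"
    using infinite_star[of x] by (simp add: E_def)
  then obtain f :: "nat \<Rightarrow> edge" where f: "bij_betw f UNIV E"
    using ex_enumeration[of E] by (auto simp: E_def)
  define q where "q n = (f n, Red)" for n
  have range_f: "range f = E"
    using f by (simp add: bij_betw_def)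
  have q_star: "\<exists>u. q n = ({x, u}, Red) \<and> u \<noteq> x" for n
  proof -
    have "f n \<in> all_edges" "x \<in> f n"
      using range_f by (auto simp: E_def)
    then show ?thesis
      unfolding q_def by (auto elim!: nsets2_E)
  qed
  have fresh: "fresh h q"
    using f by (rule fresh_if_enumeration) (auto simp: E_def q_def)
  have asked_end: "fst ` range (h \<frown> q) = asked h \<union> E"
    using range_f by (auto simp: q_def asked_def image_Un image_image)
  show ?thesis
  proof (rule winning_if_deviations_winning[OF fresh])
    have "infinite {e \<in> all_edges. Suc x \<in> e}"
      by (rule infinite_star)
    then have "infinite ({e \<in> all_edges. Suc x \<in> e} - insert {x, Suc x} (asked h))"
      by simp
    then obtain e where "e \<in> all_edges" "Suc x \<in> e" "e \<noteq> {x, Suc x}" "e \<notin> asked h"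
      using infinite_imp_nonempty by blast
    moreover from this have "x \<notin> e"
      by (auto elim!: nsets2_E)
    ultimately have "e \<in> all_edges" "e \<notin> fst ` range (h \<frown> q)"
      unfolding asked_end by (auto simp: E_def)
    then show "seeker_wins no_isolated_vertex (h \<frown> q)"
    proof (rule seeker_wins_if_isolated)
      show "d \<in> fst ` range (h \<frown> q)" if "d \<in> all_edges" "x \<in> d" for d
        using that unfolding asked_end by (auto simp: E_def)
      show "c = Red" if "(d, c) \<in> range (h \<frown> q)" "x \<in> d" for d c
        using that red by (auto simp: q_def)
    qed
    show "winning no_isolated_vertex (h @ map q [0..<n] @ [(fst (q n), c)])"
      if "c \<noteq> snd (q n)" for n c
    proof -
      obtain w where w: "q n = ({x, w}, Red)" "w \<noteq> x"
        using q_star by blast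
      moreover have "c = Green"
        using that w by (cases c) auto
      moreover have "{x, w} \<notin> asked (h @ map q [0..<n])"
        using fresh[unfolded fresh_def, rule_format, of n] w(1) by simp
      moreover have "set (map q [0..<n]) \<subseteq> {({x, u}, Red) | u. u \<noteq> x}"
        using q_star by (simp add: image_subset_iff)
      ultimately show ?thesis
        using dev[of "map q [0..<n]" w] by simp
    qed
  qed
qed

section \<open>The triangular order of pairs\<close>

text \<open>
  The pairing function lists the pairs \<open>(i, d)\<close> by rows \<open>i + d\<close>, and each row by increasing \<open>i\<close>.
\<close>

lemma triangle_mono: "i \<le> j \<Longrightarrow> triangle i \<le> triangle j"
  by (induction j) (auto simp: le_Suc_eq)

lemma prod_encode_less_iff:
  "prod_encode (i', d') < prod_encode (i, d) \<longleftrightarrow>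
    i' + d' < i + d \<or> i' + d' = i + d \<and> i' < i"
proof -
  have less: "prod_encode (i, d) < prod_encode (i', d')" if "i + d < i' + d'" for i d i' d'
    using triangle_mono[of "Suc (i + d)" "i' + d'"] that
    by (simp add: prod_encode_def)
  consider "i' + d' < i + d" | "i + d < i' + d'" | "i' + d' = i + d"
    by linarith
  then show ?thesis
  proof cases
    case 3
    then show ?thesis by (simp add: prod_encode_def)
  qed (use less in \<open>force dest: less_asym\<close>)+
qed

lemma prod_encode_ge_3_iff: "3 \<le> prod_encode (i, d) \<longleftrightarrow> 2 \<le> i + d"
proof -
  have "prod_encode (0, 2) = 3"
    by (simp add: prod_encode_def numeral_2_eq_2)
  then show ?thesis
    using prod_encode_less_iff[of i d 0 2] by auto
qed

lemma prod_decode_ge_2: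
  assumes "prod_decode (n + 3) = (i, d)"
  shows "2 \<le> i + d"
proof -
  have "n + 3 = prod_encode (i, d)"
    using assms by (metis prod_decode_inverse)
  then show ?thesis
    unfolding prod_encode_ge_3_iff[symmetric] by linarith
qed

section \<open>Growing a path of covered vertices\<close>

text \<open>
  The situation after the first green edge: every edge asked so far contains \<open>a\<close>, and \<open>K\<close> bounds the
  vertices that occur.
\<close>

locale path_phase =
  fixes h :: "turn list" and a b K :: nat
  assumes first_green: "({a, b}, Green) \<in> set h"
    and asked_star: "e \<in> asked h \<Longrightarrow> e \<in> all_edges \<and> a \<in> e"
    and asked_below: "e \<in> asked h \<Longrightarrow> w \<in> e \<Longrightarrow> w < K"
begin

text \<open>
  The vertices that become covered, in this order; each but \<open>a\<close> has a green edge to its predecessor.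
  The jump to \<open>K + 2\<close> leaves \<open>K\<close>, which is to be isolated, and \<open>Suc K\<close>, which keeps white edges, off the path.
\<close>

definition path :: "nat \<Rightarrow> nat" where
  "path j = (if j = 0 then a else if j = 1 then b else K + j)"

definition other :: "nat \<Rightarrow> nat" where
  "other s = (if s < K then s else Suc s)"

text \<open>
  Row \<open>j = i + d\<close> of the triangular order is the stage at which the vertex \<open>path j\<close> joins: entry 0
  asks one edge at \<open>K\<close>, and entry \<open>i > 0\<close> asks the edge from \<open>path j\<close> to \<open>path (i - 1)\<close>. The last entry
  has \<open>d = 0\<close> and is the green edge to the predecessor. Rows start at 2, since \<open>path 0 = a\<close> and
  \<open>path 1 = b\<close> are covered from the beginning; so row \<open>j\<close> asks the edge from \<open>K\<close> to \<open>other (j - 2)\<close>.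
  With it, only \<open>j - 1\<close> edges at \<open>K\<close> have been asked, while \<open>j\<close> path vertices are covered.
\<close>

fun move :: "nat \<times> nat \<Rightarrow> turn" where
  "move (i, d) =
    (if i = 0 then ({K, other (d - 2)}, Red)
     else ({path (i + d), path (i - 1)}, if d = 0 then Green else Red))"

text \<open>
  Rows 0 and 1 contain three pairs, hence the shift by 3.
\<close>

definition line :: play where
  "line n = move (prod_decode (n + 3))"

lemma first_edge: "a \<noteq> b" "a < K" "b < K" "{a, b} \<in> asked h"
proof -
  show "{a, b} \<in> asked h"
    using first_green by (force simp: asked_def)
  then show "a \<noteq> b" "a < K" "b < K"
    using asked_star[of "{a, b}"] asked_below[of "{a, b}"] by auto
qed

lemma path_eq_iff [simp]: "path r = path s \<longleftrightarrow> r = s"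
  using first_edge by (auto simp: path_def)

lemma path_neq [simp]: "path r \<noteq> K" "path r \<noteq> Suc K" "K \<noteq> path r" "Suc K \<noteq> path r"
  using first_edge by (auto simp: path_def)

lemma other_eq_iff [simp]: "other r = other s \<longleftrightarrow> r = s"
  by (auto simp: other_def)

lemma other_neq [simp]: "other s \<noteq> K" "K \<noteq> other s"
  by (auto simp: other_def)

lemma ex_other: "w \<noteq> K \<Longrightarrow> \<exists>s. w = other s"
  by (rule exI[of _ "if w < K then w else w - 1"]) (auto simp: other_def)

lemma K_not_asked: "e \<in> asked h \<Longrightarrow> K \<notin> e"
  using asked_below by blast

lemma path_not_asked: "2 \<le> r \<Longrightarrow> e \<in> asked h \<Longrightarrow> path r \<notin> e"
  using asked_below[of e "path r"] by (auto simp: path_def)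

lemma set_line_prefix:
  assumes "prod_decode (n + 3) = (i, d)"
  shows "set (map line [0..<n]) =
    {move (i', d') | i' d'. 2 \<le> i' + d' \<and> (i' + d' < i + d \<or> i' + d' = i + d \<and> i' < i)}"
    (is "?L = ?R")
proof
  have n: "n + 3 = prod_encode (i, d)"
    using assms by (metis prod_decode_inverse)
  show "?L \<subseteq> ?R"
  proof
    fix t assume "t \<in> ?L"
    then obtain m where m: "m < n" "t = line m" by auto
    obtain i' d' where id: "prod_decode (m + 3) = (i', d')" by fastforce
    then have "m + 3 = prod_encode (i', d')" by (metis prod_decode_inverse)
    then have "3 \<le> prod_encode (i', d')" "prod_encode (i', d') < prod_encode (i, d)"
      using m n by linarith+
    then have "2 \<le> i' + d'" "i' + d' < i + d \<or> i' + d' = i + d \<and> i' < i"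
      unfolding prod_encode_ge_3_iff prod_encode_less_iff by blast+
    moreover have "t = move (i', d')"
      unfolding m(2) line_def id ..
    ultimately show "t \<in> ?R"
      by blast
  qed
  show "?R \<subseteq> ?L"
  proof
    fix t assume "t \<in> ?R"
    then obtain i' d' where id: "t = move (i', d')" "3 \<le> prod_encode (i', d')"
        "prod_encode (i', d') < prod_encode (i, d)"
      unfolding prod_encode_ge_3_iff prod_encode_less_iff by blast
    then have "t = line (prod_encode (i', d') - 3)" "prod_encode (i', d') - 3 < n"
      using n by (simp_all add: line_def del: move.simps)
    then show "t \<in> ?L"
      by (simp del: move.simps)
  qed
qed

lemma asked_line_prefix:
  assumes "prod_decode (n + 3) = (i, d)"
  shows "asked (map line [0..<n]) =
    {{K, other s} | s. s + 2 < i + d \<or> s + 2 = i + d \<and> 0 < i} \<union>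
    {{path r, path c} | r c. 2 \<le> r \<and> c < r \<and> (r < i + d \<or> r = i + d \<and> Suc c < i)}"
    (is "_ = ?A \<union> ?B")
proof
  let ?before = "\<lambda>i' d'. 2 \<le> i' + d' \<and> (i' + d' < i + d \<or> i' + d' = i + d \<and> i' < i)"
  have asked: "asked (map line [0..<n]) = {fst (move (i', d')) | i' d'. ?before i' d'}"
    unfolding asked_def set_line_prefix[OF assms] by blast
  show "asked (map line [0..<n]) \<subseteq> ?A \<union> ?B"
  proof
    fix e assume "e \<in> asked (map line [0..<n])"
    then obtain i' d' where e: "e = fst (move (i', d'))" and b: "?before i' d'"
      unfolding asked by blast
    show "e \<in> ?A \<union> ?B"
    proof (cases "i' = 0")
      case True
      then have "e = {K, other (d' - 2)} \<and> (d' - 2 + 2 < i + d \<or> d' - 2 + 2 = i + d \<and> 0 < i)"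
        using e b by auto
      then show ?thesis by blast
    next
      case False
      then have "e = {path (i' + d'), path (i' - 1)} \<and> 2 \<le> i' + d' \<and> i' - 1 < i' + d' \<and>
          (i' + d' < i + d \<or> i' + d' = i + d \<and> Suc (i' - 1) < i)"
        using e b by auto
      then show ?thesis by blast
    qed
  qed
  have "{K, other s} \<in> asked (map line [0..<n])" if "s + 2 < i + d \<or> s + 2 = i + d \<and> 0 < i" for s
  proof -
    have "{K, other s} = fst (move (0, s + 2)) \<and> ?before 0 (s + 2)"
      using that by auto
    then show ?thesis unfolding asked by blast
  qed
  moreover have "{path r, path c} \<in> asked (map line [0..<n])"
    if "2 \<le> r" "c < r" "r < i + d \<or> r = i + d \<and> Suc c < i" for r c
  proof -
    have "{path r, path c} = fst (move (Suc c, r - Suc c)) \<and> ?before (Suc c) (r - Suc c)"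
      using that by auto
    then show ?thesis unfolding asked by blast
  qed
  ultimately show "?A \<union> ?B \<subseteq> asked (map line [0..<n])"
    by blast
qed

lemma fresh_line: "fresh h line"
  unfolding fresh_def
proof
  fix n
  obtain i d where id: "prod_decode (n + 3) = (i, d)" by fastforce
  then have ge: "2 \<le> i + d"
    by (rule prod_decode_ge_2)
  have line_n: "line n = move (i, d)"
    by (simp add: line_def id)
  show "fst (line n) \<in> all_edges - asked (h @ map line [0..<n])"
  proof (cases "i = 0")
    case True
    then show ?thesis
      using ge K_not_asked by (auto simp: line_n asked_line_prefix[OF id] doubleton_eq_iff)
  next
    case False
    then show ?thesis
      using path_not_asked[OF ge] by (auto simp: line_n asked_line_prefix[OF id] doubleton_eq_iff)
  qed
qed

lemma covered_path:
  assumes id: "prod_decode (n + 3) = (i, d)" and "c < i + d" "2 \<le> i + d"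
  shows "covered (h @ map line [0..<n]) (path c)"
proof (cases "c < 2")
  case True
  then have "path c \<in> {a, b}"
    by (auto simp: path_def)
  then have "covered h (path c)"
    unfolding covered_def using first_green by blast
  then show ?thesis by simp
next
  case False
  then have "2 \<le> c + 0 \<and> (c + 0 < i + d \<or> c + 0 = i + d \<and> c < i)"
    using assms(2) by simp
  then have "move (c, 0) \<in> set (map line [0..<n])"
    unfolding set_line_prefix[OF id] by blast
  moreover have "move (c, 0) = ({path c, path (c - 1)}, Green)"
    using False by simp
  ultimately have "covered (map line [0..<n]) (path c)"
    unfolding covered_def by (metis insertI1)
  then show ?thesis by simp
qed

text \<open>
  Up to entry 0 of row \<open>j\<close>, fewer edges at \<open>K\<close> have been asked than there are covered path vertices,
  so by the pigeonhole principle one of these vertices still has a white edge to \<open>K\<close>.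
\<close>

lemma ex_path_not_among_other:
  assumes "0 < j"
  shows "\<exists>c<j. path c \<notin> other ` {s. s + 2 \<le> j}"
proof (rule ccontr)
  assume "\<not> ?thesis"
  then have "path ` {..<j} \<subseteq> other ` {s. s + 2 \<le> j}"
    by auto
  moreover have "{s. s + 2 \<le> j} = {..<j - 1}"
    by auto
  ultimately have "card (path ` {..<j}) \<le> card {..<j - 1}"
    by (metis card_image_le card_mono finite_imageI finite_lessThan le_trans)
  moreover have "card (path ` {..<j}) = j"
    by (subst card_image) (auto simp: inj_on_def)
  ultimately show False
    using assms by simp
qed

text \<open>
  If Hider answers red to the last edge from \<open>path j\<close> to the covered path vertices, Seeker tries to
  isolate \<open>path j\<close>. A green answer covers some \<open>w\<close> other than the path vertices before \<open>path j\<close>, and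
  this \<open>w\<close> has a white edge to one of them: to \<open>b\<close> if \<open>w\<close> is not \<open>K\<close>, and by counting if it is.
\<close>

lemma winning_after_last_red:
  assumes id: "prod_decode (n + 3) = (j, 0)" and j: "2 \<le> j"
  shows "winning no_isolated_vertex (h @ map line [0..<n] @ [({path j, path (j - 1)}, Red)])"
    (is "winning _ ?H")
proof (rule winning_star)
  have asked_H: "asked ?H = asked h \<union> asked (map line [0..<n]) \<union> {{path j, path (j - 1)}}"
    by (auto simp: asked_def)
  have cov: "covered ?H (path c)" if "c < j" for c
    using covered_path[OF id, of c] that j by auto
  show "c = Red" if ec: "(e, c) \<in> set ?H" "path j \<in> e" for e c
  proof -
    have "(e, c) \<notin> set h"
      using path_not_asked[OF j, of e] ec(2) by (force simp: asked_def)
    then consider "(e, c) \<in> set (map line [0..<n])" | "c = Red"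
      using ec(1) by auto
    then show ?thesis
    proof cases
      case 1
      then obtain i' d' where m: "(e, c) = move (i', d')"
        and less: "i' + d' < j \<or> i' + d' = j \<and> i' < j"
        unfolding set_line_prefix[OF id] by auto
      show ?thesis
        using m less ec(2) by (auto split: if_splits)
    qed
  qed
  show "winning no_isolated_vertex (?H @ g @ [({path j, w}, Green)])"
    if g: "set g \<subseteq> {({path j, x}, Red) | x. x \<noteq> path j}" and w: "w \<noteq> path j" "{path j, w} \<notin> asked (?H @ g)"
    for g w
  proof -
    have new: "w \<noteq> path c" if "c < j" for c
    proof
      assume "w = path c"
      moreover have "{path j, path c} \<in> asked ?H"
      proof (cases "c = j - 1")
        case True
        then show ?thesis
          unfolding asked_H by blast
      next
        case False
        then have "2 \<le> j \<and> c < j \<and> (j < j + 0 \<or> j = j + 0 \<and> Suc c < j)"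
          using that j by simp
        then show ?thesis
          unfolding asked_H asked_line_prefix[OF id] by blast
      qed
      ultimately show False
        using w by simp
    qed
    have "\<exists>c<j. {w, path c} \<notin> asked ?H"
    proof (cases "w = K")
      case True
      obtain c where c: "c < j" "path c \<notin> other ` {s. s + 2 \<le> j}"
        using ex_path_not_among_other[of j] j by auto
      then have "{K, path c} \<notin> asked ?H"
        unfolding asked_H asked_line_prefix[OF id] using K_not_asked by (auto simp: doubleton_eq_iff)
      then show ?thesis
        using c True by blast
    next
      case False
      have "{w, path 1} \<notin> asked h"
        using asked_star[of "{w, path 1}"] new[of 0] j first_edge by (auto simp: path_def)
      moreover have "{w, path 1} \<notin> asked (map line [0..<n])" "{w, path 1} \<noteq> {path j, path (j - 1)}"
        unfolding asked_line_prefix[OF id] using False new w(1) by (auto simp: doubleton_eq_iff)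
      ultimately show ?thesis
        unfolding asked_H using j by (intro exI[of _ 1]) auto
    qed
    then obtain c where c: "c < j" "{w, path c} \<notin> asked ?H"
      by blast
    have "{w, path c} \<notin> asked (g @ [({path j, w}, Green)])"
      using g w(1) c(1) by (fastforce simp: asked_def doubleton_eq_iff)
    then have "{w, path c} \<notin> asked (?H @ g @ [({path j, w}, Green)])"
      using c(2) by simp
    moreover have "covered (?H @ g @ [({path j, w}, Green)]) w"
      by (auto simp: covered_def)
    moreover have "covered (?H @ g @ [({path j, w}, Green)]) (path c)"
      using cov[OF c(1)] by auto
    ultimately show ?thesis
      using winning_if_white_edge_between_covered new[OF c(1)] by blast
  qed
qed

text \<open>
  The vertex \<open>K\<close> ends up isolated, while no edge from \<open>Suc K\<close> to a path vertex is ever asked.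
\<close>

lemma seeker_wins_line: "seeker_wins no_isolated_vertex (h \<frown> line)"
proof -
  have range_line: "\<exists>i d. 2 \<le> i + d \<and> line n = move (i, d)" for n
  proof -
    obtain i d where id: "prod_decode (n + 3) = (i, d)" by fastforce
    then have "2 \<le> i + d"
      by (rule prod_decode_ge_2)
    then show ?thesis
      using id by (auto simp: line_def simp del: move.simps)
  qed
  have white: "{Suc K, a} \<noteq> fst (line n)" for n
  proof -
    obtain i d where "line n = move (i, d)" using range_line by blast
    then show ?thesis
      using first_edge by (auto simp: doubleton_eq_iff)
  qed
  have "{Suc K, a} \<in> all_edges" "{Suc K, a} \<notin> fst ` range (h \<frown> line)"
    using first_edge white asked_below[of "{Suc K, a}" "Suc K"]
    by (auto simp: image_Un asked_def image_image)
  then show ?thesis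
  proof (rule seeker_wins_if_isolated)
    show "e \<in> fst ` range (h \<frown> line)" if e: "e \<in> all_edges" "K \<in> e" for e
    proof -
      obtain w where w: "e = {K, w}" "w \<noteq> K"
        using e by (auto elim!: nsets2_E)
      then obtain s where s: "w = other s"
        using ex_other by blast
      have "3 \<le> prod_encode (0, s + 2)"
        unfolding prod_encode_ge_3_iff by simp
      then have "fst (line (prod_encode (0, s + 2) - 3)) = e"
        by (simp add: line_def w s)
      then show ?thesis
        by (auto simp: image_Un image_image)
    qed
    show "c = Red" if ec: "(e, c) \<in> range (h \<frown> line)" "K \<in> e" for e c
    proof -
      have "(e, c) \<notin> set h"
        using K_not_asked[of e] ec(2) by (force simp: asked_def)
      then obtain n where "(e, c) = line n"
        using ec(1) by auto
      then obtain i d where "(e, c) = move (i, d)"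
        using range_line by metis
      then show ?thesis
        using ec(2) by (auto split: if_splits)
    qed
  qed
qed

text \<open>
  Each wrong answer of Hider along \<open>line\<close> loses. A green answer at \<open>K\<close>, or at \<open>path j\<close> before the last
  entry of its row, produces a covered vertex with a white edge to an older covered vertex; the
  third case is a red answer at the last entry.
\<close>

lemma winning_after_first_green: "winning no_isolated_vertex h"
proof (rule winning_if_deviations_winning[OF fresh_line seeker_wins_line])
  fix n c assume c: "c \<noteq> snd (line n)"
  obtain i d where id: "prod_decode (n + 3) = (i, d)" by fastforce
  then have ge: "2 \<le> i + d"
    by (rule prod_decode_ge_2)
  have line_n: "line n = move (i, d)"
    by (simp add: line_def id)
  let ?H = "h @ map line [0..<n] @ [(fst (line n), c)]"
  have cov: "covered ?H (path r)" if "r < i + d" for r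
    using covered_path[OF id that ge] by auto
  have asked_H: "asked ?H = asked h \<union> asked (map line [0..<n]) \<union> {fst (line n)}"
    by (auto simp: asked_def)
  show "winning no_isolated_vertex ?H"
  proof (cases "i = 0")
    case True
    obtain r where r: "r < d" "path r \<notin> other ` {s. s + 2 \<le> d}"
      using ex_path_not_among_other[of d] ge True by auto
    have "c = Green"
      using c True line_n by (cases c) auto
    then have "covered ?H K"
      using True by (auto simp: covered_def line_n)
    moreover have "path r \<noteq> other (d - 2)"
      using r(2) ge True by (metis (mono_tags, lifting) add_0 imageI le_add_diff_inverse2
          mem_Collect_eq order_refl)
    then have "{K, path r} \<notin> asked ?H"
      unfolding asked_H asked_line_prefix[OF id] unfolding line_n
      using K_not_asked r True by (auto simp: doubleton_eq_iff)
    ultimately show ?thesis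
      using winning_if_white_edge_between_covered cov[of r] r True by (metis add_0 path_neq(3))
  next
    case False
    show ?thesis
    proof (cases "d = 0")
      case True
      then have "c = Red"
        using c False line_n by (cases c) auto
      then have "(fst (line n), c) = ({path i, path (i - 1)}, Red)"
        using True False by (simp add: line_n)
      then show ?thesis
        using winning_after_last_red[of n i] id ge True by simp
    next
      case d: False
      then have "c = Green"
        using c False line_n by (cases c) auto
      then have "covered ?H (path (i + d))"
        using False by (auto simp: covered_def line_n)
      moreover have "{path (i + d), path i} \<notin> asked ?H"
        unfolding asked_H asked_line_prefix[OF id] unfolding line_n
        using path_not_asked[OF ge] False d by (auto simp: doubleton_eq_iff)
      ultimately show ?thesis
        using winning_if_white_edge_between_covered cov[of i] d
        by (metis add.right_neutral add_left_cancel less_add_same_cancel1 not_gr_zero path_eq_iff)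
    qed
  qed
qed

end

theorem theorem4p2:
  shows "\<not> infinitely_elusive no_isolated_vertex"
proof -
  have "winning no_isolated_vertex []"
  proof (rule winning_star[where x = 0])
    fix g :: "turn list" and w :: nat
    assume g: "set g \<subseteq> {({0, u}, Red) | u. u \<noteq> 0}" and w: "w \<noteq> 0"
    let ?h = "g @ [({0, w}, Green)]"
    have star: "e \<in> all_edges \<and> 0 \<in> e" if "e \<in> asked ?h" for e
      using that g w by (fastforce simp: asked_def)
    have "finite (\<Union> (asked ?h))"
      using star by (intro finite_Union) (auto simp: nsets_def)
    then obtain K where "\<Union> (asked ?h) \<subseteq> {..<K}"
      using finite_nat_iff_bounded by blast
    then interpret path_phase ?h 0 w K
      using star by unfold_locales auto
    show "winning no_isolated_vertex ([] @ g @ [({0, w}, Green)])"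
      using winning_after_first_green by simp
  qed simp
  then show ?thesis
    by (simp add: infinitely_elusive_def winning_Nil_iff)
qed

end
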